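(* For a Tychonoff space $Y$ the following assertions are equivalent: (i) $Y$ is a locally pseudocompact $s_{\mathbb{R}}$-space; (ii) $X\times Y$ is an $s_{\mathbb{R}}$-space for each (Tychonoff) $s_{\mathbb{R}}$-space $X$; (iii) $X\times Y$ is an $s_{\mathbb{R}}$-space for each (Tychonoff) Fréchet–Urysohn space $X$.
   Context: All spaces are assumed to be Tychonoff. A function $f:X\to\mathbb{R}$ is sequentially continuous ($s$-continuous) if the restriction of $f$ to each convergent sequence in $X$ (together with its limit) is continuous; $X$ is an $s_{\mathbb{R}}$-space if every sequentially continuous function $f:X\to\mathbb{R}$ is continuous. A space is pseudocompact if every continuous real-valued function on it is bounded; $X$ is locally pseudocompact if every point of $X$ has a neighborhood which is a pseudocompact space. A space $X$ is Fréchet–Urysohn if for every $A\subseteq X$ and every point $a\in\overline{A}$ there is a sequence in $A$ converging to $a$. *)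

theory Defs
  imports "HOL-Analysis.Analysis"
begin

definition tychonoff_space :: "'a topology \<Rightarrow> bool" where
  "tychonoff_space X \<longleftrightarrow> completely_regular_space X \<and> Hausdorff_space X"

definition s_continuous :: "'a topology \<Rightarrow> ('a \<Rightarrow> real) \<Rightarrow> bool" where
  "s_continuous X f \<longleftrightarrow>
    (\<forall>\<sigma> l. range \<sigma> \<subseteq> topspace X \<and> limitin X \<sigma> l sequentially \<longrightarrow>
       continuous_map (subtopology X (insert l (range \<sigma>))) euclideanreal f)"

definition s_R_space :: "'a topology \<Rightarrow> bool" where
  "s_R_space X \<longleftrightarrow> (\<forall>f. s_continuous X f \<longrightarrow> continuous_map X euclideanreal f)"

definition pseudocompact_space :: "'a topology \<Rightarrow> bool" where
  "pseudocompact_space X \<longleftrightarrow>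
    (\<forall>f. continuous_map X euclideanreal f \<longrightarrow> bounded (f ` topspace X))"

(* Neighbourhoods need not be open, as in locally_compact_space. *)
definition locally_pseudocompact_space :: "'a topology \<Rightarrow> bool" where
  "locally_pseudocompact_space X \<longleftrightarrow>
    (\<forall>x \<in> topspace X. \<exists>U N. openin X U \<and> x \<in> U \<and> U \<subseteq> N \<and> N \<subseteq> topspace X \<and>
       pseudocompact_space (subtopology X N))"

definition frechet_urysohn_space :: "'a topology \<Rightarrow> bool" where
  "frechet_urysohn_space X \<longleftrightarrow>
    (\<forall>A a. A \<subseteq> topspace X \<and> a \<in> X closure_of A \<longrightarrow>
       (\<exists>\<sigma>. range \<sigma> \<subseteq> A \<and> limitin X \<sigma> a sequentially))"

end

theory Submission
  imports Defs
begin

text \<open>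
  For (i) to (ii), let \<open>f\<close> be sequentially continuous on the product and let \<open>N\<close> be a pseudocompact
  neighbourhood of \<open>b\<close>. If \<open>x\<^sub>n\<close> converges to \<open>x\<close>, then \<open>sup\<^bsub>n\<ge>m\<^esub> \<bar>f(x\<^sub>n, y) - f(x, y)\<bar>\<close> is sequentially
  continuous in \<open>y\<close>, hence continuous, and decreases pointwise to 0, so by Dini's theorem on \<open>N\<close> it
  does so uniformly. Therefore \<open>x \<mapsto> sup\<^bsub>y\<in>N\<^esub> \<bar>f(x, y) - f(a, y)\<bar>\<close> is sequentially continuous, hence
  continuous, and it vanishes at \<open>a\<close>; this gives continuity of \<open>f\<close> at \<open>(a, b)\<close>.

  For (iii) to (i), suppose that no neighbourhood of \<open>y\<^sub>0\<close> is pseudocompact. Every open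
  neighbourhood \<open>U\<close> of \<open>y\<^sub>0\<close> then carries a sequence of bumps \<open>\<phi>\<^bsub>U,n\<^esub>\<close> of height 1 with locally
  finite supports. Let \<open>X\<close> be the sequential fan with one branch per \<open>U\<close>. The function on \<open>X \<times> Y\<close>
  that is \<open>\<phi>\<^bsub>U,n\<^esub>\<close> over the \<open>n\<close>-th point of branch \<open>U\<close> and 0 over the apex is sequentially
  continuous, as a sequence tending to the apex meets only finitely many branches, but it is
  discontinuous at \<open>(apex, y\<^sub>0)\<close>.
\<close>

subsection \<open>Sequentially continuous functions\<close>

lemma s_continuousD:
  assumes "s_continuous X f" "range \<sigma> \<subseteq> topspace X" "limitin X \<sigma> l sequentially"
  shows "(\<lambda>n. f (\<sigma> n)) \<longlonglongrightarrow> f l"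
proof -
  let ?S = "insert l (range \<sigma>)"
  have "continuous_map (subtopology X ?S) euclideanreal f"
    using assms unfolding s_continuous_def by blast
  moreover have "limitin (subtopology X ?S) \<sigma> l sequentially"
    using assms(3) by (simp add: limitin_subtopology)
  ultimately have "limitin euclideanreal (f \<circ> \<sigma>) (f l) sequentially"
    by (rule continuous_map_limit)
  then show ?thesis by (simp add: comp_def)
qed

text \<open>In a Hausdorff space, limits along sequences suffice for continuity on a sequence with
  its limit. The preimage of a closed set there is a subset of the sequence together with the limit,
  hence compact, if \<open>f l\<close> lies in that set. Otherwise it is finite. Both are
  closed.\<close>

lemma s_continuousI:
  assumes "Hausdorff_space X"
    and lim: "\<And>\<sigma> l. range \<sigma> \<subseteq> topspace X \<Longrightarrow> limitin X \<sigma> l sequentially \<Longrightarrow> (\<lambda>n. f (\<sigma> n)) \<longlonglongrightarrow> f l"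
  shows "s_continuous X f"
  unfolding s_continuous_def
proof (intro allI impI, elim conjE)
  fix \<sigma> :: "nat \<Rightarrow> 'a" and l
  assume ran: "range \<sigma> \<subseteq> topspace X" and l: "limitin X \<sigma> l sequentially"
  let ?S = "insert l (range \<sigma>)"
  have S: "?S \<subseteq> topspace X" using ran limitin_topspace[OF l] by simp
  show "continuous_map (subtopology X ?S) euclideanreal f"
    unfolding continuous_map_closedin
  proof (intro conjI allI impI)
    fix C :: "real set" assume "closedin euclideanreal C"
    then have C: "closed C" by simp
    let ?T = "{x \<in> ?S. f x \<in> C}"
    have "closedin X ?T"
    proof (cases "f l \<in> C")
      case True
      then have "?T = insert l {x \<in> range \<sigma>. f x \<in> C}" by auto
      moreover have "compactin X (insert l {x \<in> range \<sigma>. f x \<in> C})"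
        using ran by (intro compactin_sequence_with_limit[OF l]) auto
      ultimately show ?thesis
        using assms(1) by (simp add: compactin_imp_closedin)
    next
      case False
      have "\<forall>\<^sub>F n in sequentially. f (\<sigma> n) \<in> - C"
        using lim[OF ran l] False C by (intro topological_tendstoD) auto
      then obtain N where N: "\<And>n. n \<ge> N \<Longrightarrow> f (\<sigma> n) \<notin> C"
        unfolding eventually_sequentially by auto
      have "?T \<subseteq> \<sigma> ` {..<N}"
        using N False by (auto simp: not_less[symmetric])
      then have "finite ?T" by (rule finite_subset) simp
      then show ?thesis
        using S by (intro closedin_Hausdorff_finite[OF assms(1)]) auto
    qed
    moreover have "{x \<in> topspace (subtopology X ?S). f x \<in> C} = ?T \<inter> ?S" using S by auto
    ultimately show "closedin (subtopology X ?S) {x \<in> topspace (subtopology X ?S). f x \<in> C}"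
      unfolding closedin_subtopology by blast
  qed simp
qed

lemma s_continuous_compose:
  assumes "continuous_map X Y g" "s_continuous Y f" "Hausdorff_space X"
  shows "s_continuous X (f \<circ> g)"
proof (rule s_continuousI)
  fix \<sigma> l assume "range \<sigma> \<subseteq> topspace X" "limitin X \<sigma> l sequentially"
  moreover have "range (g \<circ> \<sigma>) \<subseteq> topspace Y"
    using continuous_map_image_subset_topspace[OF assms(1)] calculation(1) by auto
  ultimately show "(\<lambda>n. (f \<circ> g) (\<sigma> n)) \<longlonglongrightarrow> (f \<circ> g) l"
    using s_continuousD[OF assms(2), of "g \<circ> \<sigma>" "g l"] continuous_map_limit[OF assms(1), of \<sigma> l sequentially]
    by (simp add: comp_def)
qed (fact assms)

text \<open>Every closure point of the preimage of a closed set is the limit of a sequence in that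
  preimage, so sequential continuity keeps the point in the preimage. This makes (iii) a special
  case of (ii).\<close>

lemma frechet_urysohn_imp_s_R_space:
  assumes "frechet_urysohn_space X"
  shows "s_R_space X"
  unfolding s_R_space_def
proof (intro allI impI)
  fix f assume f: "s_continuous X f"
  show "continuous_map X euclideanreal f"
    unfolding continuous_map_closedin
  proof (intro conjI allI impI)
    fix C :: "real set" assume "closedin euclideanreal C"
    then have C: "closed C" by simp
    let ?A = "{x \<in> topspace X. f x \<in> C}"
    have "f a \<in> C" if a: "a \<in> X closure_of ?A" for a
    proof -
      obtain \<sigma> where \<sigma>: "range \<sigma> \<subseteq> ?A" "limitin X \<sigma> a sequentially"
        using assms a unfolding frechet_urysohn_space_def by (metis (no_types, lifting) mem_Collect_eq subsetI)
      then have "range \<sigma> \<subseteq> topspace X" by auto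
      from C _ s_continuousD[OF f this \<sigma>(2)] show ?thesis
        by (rule closed_sequentially) (use \<sigma>(1) in auto)
    qed
    then show "closedin X ?A"
      by (intro closure_of_subset_eq[THEN iffD1]) (auto simp: in_closure_of)
  qed simp
qed

section \<open>Real-valued functions: suprema and Dini's theorem\<close>

lemma continuous_map_real_eps:
  fixes f :: "'a \<Rightarrow> real"
  shows "continuous_map X euclideanreal f \<longleftrightarrow>
    (\<forall>x\<in>topspace X. \<forall>e>0. \<exists>U. openin X U \<and> x \<in> U \<and> (\<forall>y\<in>U. \<bar>f y - f x\<bar> < e))"
  using Met_TC.continuous_map_to_metric[of X f]
  by (simp add: dist_real_def abs_minus_commute)

lemma abs_cSUP_diff_le:
  fixes a b :: "'i \<Rightarrow> real"
  assumes "I \<noteq> {}" "bdd_above (a ` I)" "bdd_above (b ` I)" "\<And>i. i \<in> I \<Longrightarrow> \<bar>a i - b i\<bar> \<le> e"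
  shows "\<bar>(SUP i\<in>I. a i) - (SUP i\<in>I. b i)\<bar> \<le> e"
proof -
  have "(SUP i\<in>I. a i) \<le> (SUP i\<in>I. b i) + e"
  proof (rule cSUP_least[OF assms(1)])
    fix i assume "i \<in> I"
    then show "a i \<le> (SUP i\<in>I. b i) + e"
      using assms(4)[of i] cSUP_upper[OF _ assms(3), of i] by linarith
  qed
  moreover have "(SUP i\<in>I. b i) \<le> (SUP i\<in>I. a i) + e"
  proof (rule cSUP_least[OF assms(1)])
    fix i assume "i \<in> I"
    then show "b i \<le> (SUP i\<in>I. a i) + e"
      using assms(4)[of i] cSUP_upper[OF _ assms(2), of i] by linarith
  qed
  ultimately show ?thesis by linarith
qed

text \<open>If the convergence were not uniform, the locally finite sum of the truncations of \<open>h m\<close>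
  below at \<open>e / 2\<close> would be continuous and unbounded.\<close>

lemma pseudocompact_Dini:
  fixes h :: "nat \<Rightarrow> 'a \<Rightarrow> real"
  assumes "pseudocompact_space X"
    and cont: "\<And>m. continuous_map X euclideanreal (h m)"
    and dec: "\<And>y m n. y \<in> topspace X \<Longrightarrow> m \<le> n \<Longrightarrow> h n y \<le> h m y"
    and lim: "\<And>y. y \<in> topspace X \<Longrightarrow> (\<lambda>m. h m y) \<longlonglongrightarrow> 0"
    and "e > 0"
  shows "\<exists>m. \<forall>y\<in>topspace X. h m y < e"
proof (rule ccontr)
  assume neg: "\<not> ?thesis"
  define t where "t m y = max 0 (h m y - e/2)" for m y
  define G where "G y = (\<Sum>m. t m y)" for y
  have small: "\<exists>M. h M y < e/2" if "y \<in> topspace X" for y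
    using order_tendstoD(2)[OF lim[OF that], of "e/2"] \<open>e > 0\<close>
    by (auto simp: eventually_sequentially)
  \<comment> \<open>Since \<open>h\<close> decreases in its index, every truncation from
    \<open>M\<close> on vanishes at a point where \<open>h M\<close> is below \<open>e/2\<close>.
    The set of such points is open, so \<open>G\<close> is locally a fixed finite sum.\<close>
  have G: "G y = (\<Sum>m<M. t m y)" if "y \<in> topspace X" "h M y < e/2" for y M
    unfolding G_def
  proof (rule suminf_finite)
    fix n assume "n \<notin> {..<M}"
    then show "t n y = 0" using dec[of y M n] that by (auto simp: t_def)
  qed simp
  have "continuous_map X euclideanreal G"
    unfolding continuous_map_real_eps
  proof (intro ballI allI impI)
    fix y and d :: real assume y: "y \<in> topspace X" and d: "d > 0"
    obtain M where M: "h M y < e/2" using small[OF y] by blast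
    let ?P = "\<lambda>y. \<Sum>m<M. t m y"
    have "continuous_map X euclideanreal ?P"
      unfolding t_def by (intro continuous_intros cont) auto
    then obtain U where U: "openin X U" "y \<in> U" "\<And>z. z \<in> U \<Longrightarrow> \<bar>?P z - ?P y\<bar> < d"
      using y d unfolding continuous_map_real_eps by metis
    let ?V = "{z \<in> topspace X. h M z \<in> {..<e/2}}"
    have "openin X ?V"
      using cont[of M] by (rule openin_continuous_map_preimage) simp
    then have "openin X (U \<inter> ?V)" using U(1) by blast
    moreover have "y \<in> U \<inter> ?V" using U y M by simp
    moreover have "\<bar>G z - G y\<bar> < d" if "z \<in> U \<inter> ?V" for z
      using that U(3)[of z] G[OF y M] G[of z M] by simp
    ultimately show "\<exists>U. openin X U \<and> y \<in> U \<and> (\<forall>z\<in>U. \<bar>G z - G y\<bar> < d)" by blast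
  qed
  then have "bounded (G ` topspace X)"
    using assms(1) unfolding pseudocompact_space_def by blast
  then obtain B where B: "\<And>y. y \<in> topspace X \<Longrightarrow> \<bar>G y\<bar> \<le> B"
    unfolding bounded_iff by auto
  \<comment> \<open>At a point where \<open>h m\<close> is at least \<open>e\<close>, each of the
    first \<open>m\<close> truncations is at least \<open>e/2\<close>; this \<open>m\<close> pushes
    their sum beyond the bound \<open>B\<close>.\<close>
  obtain m where m: "B < real m * (e/2)"
    using reals_Archimedean3[of "e/2"] \<open>e > 0\<close> by auto
  obtain y where y: "y \<in> topspace X" "h m y \<ge> e" using neg by (meson not_less)
  obtain M where M: "h M y < e/2" using small[OF y(1)] by blast
  have "m \<le> M"
    using dec[OF y(1), of M m] M y(2) \<open>e > 0\<close> by (cases "m \<le> M") auto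
  have "real m * (e/2) = (\<Sum>i<m. e/2)" by simp
  also have "\<dots> \<le> (\<Sum>i<m. t i y)"
  proof (rule sum_mono)
    fix i assume "i \<in> {..<m}"
    then have "e \<le> h i y" using dec[OF y(1), of i m] y(2) by simp
    then show "e/2 \<le> t i y" unfolding t_def by linarith
  qed
  also have "\<dots> \<le> (\<Sum>i<M. t i y)"
    using \<open>m \<le> M\<close> by (intro sum_mono2) (auto simp: t_def)
  also have "\<dots> = G y" using G[OF y(1) M] by simp
  finally show False using B[OF y(1)] m by linarith
qed

subsection \<open>Products with locally pseudocompact spaces\<close>

text \<open>Joint convergence to \<open>f (x, y)\<close> controls all pairs with both indices large.
  Only finitely many \<open>n\<close> remain, and for each of them convergence in \<open>k\<close>
  alone is enough. The uniformity in \<open>n\<close> is what allows a supremum over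
  \<open>n\<close> to be taken later.\<close>

lemma s_continuous_prod_uniform:
  assumes f: "s_continuous (prod_topology X Y) f"
    and \<sigma>: "range \<sigma> \<subseteq> topspace X" "limitin X \<sigma> x sequentially"
    and \<tau>: "range \<tau> \<subseteq> topspace Y" "limitin Y \<tau> y sequentially"
    and "e > 0"
  shows "\<exists>K. \<forall>k\<ge>K. \<forall>n. \<bar>f (\<sigma> n, \<tau> k) - f (\<sigma> n, y)\<bar> < e"
proof -
  have y: "y \<in> topspace Y" using \<tau>(2) by (rule limitin_topspace)
  have lim: "(\<lambda>n. f (\<alpha> n, \<beta> n)) \<longlonglongrightarrow> f (a, b)"
    if "range \<alpha> \<subseteq> topspace X" "limitin X \<alpha> a sequentially"
      "range \<beta> \<subseteq> topspace Y" "limitin Y \<beta> b sequentially" for \<alpha> \<beta> a b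
    using that by (intro s_continuousD[OF f]) (auto simp: limitin_pairwise comp_def)
  have "\<exists>M. \<forall>n\<ge>M. \<forall>k\<ge>M. \<bar>f (\<sigma> n, \<tau> k) - f (x, y)\<bar> < e/2"
  proof (rule ccontr)
    assume "\<not> ?thesis"
    then have "\<forall>M. \<exists>n k. n \<ge> M \<and> k \<ge> M \<and> \<bar>f (\<sigma> n, \<tau> k) - f (x, y)\<bar> \<ge> e/2"
      by (meson not_less)
    \<comment> \<open>The indices need not increase: \<open>p M \<ge> M\<close> and
      \<open>q M \<ge> M\<close> already make the reindexed sequences converge to the same
      limits.\<close>
    then obtain p q where pq: "\<And>M. p M \<ge> M" "\<And>M. q M \<ge> M"
        "\<And>M. \<bar>f (\<sigma> (p M), \<tau> (q M)) - f (x, y)\<bar> \<ge> e/2"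
      by metis
    have "limitin X (\<lambda>M. \<sigma> (p M)) x sequentially" "limitin Y (\<lambda>M. \<tau> (q M)) y sequentially"
      using \<sigma>(2) \<tau>(2) pq(1,2) unfolding limitin_sequentially by (meson order_trans)+
    then have "(\<lambda>M. f (\<sigma> (p M), \<tau> (q M))) \<longlonglongrightarrow> f (x, y)"
      using \<sigma>(1) \<tau>(1) by (intro lim) auto
    then obtain M where "\<bar>f (\<sigma> (p M), \<tau> (q M)) - f (x, y)\<bar> < e/2"
      using LIMSEQ_D[of _ "f (x, y)" "e/2"] \<open>e > 0\<close> by fastforce
    then show False using pq(3)[of M] by simp
  qed
  then obtain M where M: "\<And>n k. n \<ge> M \<Longrightarrow> k \<ge> M \<Longrightarrow> \<bar>f (\<sigma> n, \<tau> k) - f (x, y)\<bar> < e/2"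
    by blast
  have "(\<lambda>n. f (\<sigma> n, y)) \<longlonglongrightarrow> f (x, y)"
    using y \<sigma> by (intro lim) auto
  then obtain M' where M': "\<And>n. n \<ge> M' \<Longrightarrow> \<bar>f (\<sigma> n, y) - f (x, y)\<bar> < e/2"
    using LIMSEQ_D[of _ "f (x, y)" "e/2"] \<open>e > 0\<close> by fastforce
  have "\<forall>\<^sub>F k in sequentially. \<bar>f (\<sigma> n, \<tau> k) - f (\<sigma> n, y)\<bar> < e" for n
  proof -
    have "(\<lambda>k. f (\<sigma> n, \<tau> k)) \<longlonglongrightarrow> f (\<sigma> n, y)"
      using \<sigma>(1) \<tau> by (intro lim) auto
    from tendstoD[OF this \<open>e > 0\<close>] show ?thesis by (simp add: dist_real_def)
  qed
  then have "\<forall>\<^sub>F k in sequentially. \<forall>n\<in>{..<max M M'}. \<bar>f (\<sigma> n, \<tau> k) - f (\<sigma> n, y)\<bar> < e"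
    by (intro eventually_ball_finite) auto
  then obtain K where K: "\<And>k n. k \<ge> K \<Longrightarrow> n < max M M' \<Longrightarrow> \<bar>f (\<sigma> n, \<tau> k) - f (\<sigma> n, y)\<bar> < e"
    unfolding eventually_sequentially by auto
  have "\<bar>f (\<sigma> n, \<tau> k) - f (\<sigma> n, y)\<bar> < e" if "k \<ge> max K M" for n k
  proof (cases "n < max M M'")
    case True
    then show ?thesis using K[of k n] that by simp
  next
    case False
    then have "n \<ge> M" "n \<ge> M'" "k \<ge> M" using that by auto
    then show ?thesis using M[of n k] M'[of n] by linarith
  qed
  then show ?thesis by blast
qed

text \<open>The tail suprema \<open>h m\<close> replace the differences \<open>d n\<close> because
  Dini's theorem needs a decreasing sequence. They are continuous in \<open>y\<close> because they
  are sequentially continuous and \<open>Y\<close> is an \<open>s_R_space\<close>.\<close>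

lemma s_continuous_prod_uniform_on_pseudocompact:
  assumes "Hausdorff_space Y" "s_R_space Y"
    and f: "s_continuous (prod_topology X Y) f"
    and \<sigma>: "range \<sigma> \<subseteq> topspace X" "limitin X \<sigma> x sequentially"
    and N: "N \<subseteq> topspace Y" "pseudocompact_space (subtopology Y N)"
    and "e > 0"
  shows "\<exists>m. \<forall>n\<ge>m. \<forall>y\<in>N. \<bar>f (\<sigma> n, y) - f (x, y)\<bar> < e"
proof -
  define d where "d n y = \<bar>f (\<sigma> n, y) - f (x, y)\<bar>" for n y
  define h where "h m y = (SUP n\<in>{m..}. d n y)" for m y
  have x: "x \<in> topspace X" using \<sigma>(2) by (rule limitin_topspace)
  have d0: "(\<lambda>n. d n y) \<longlonglongrightarrow> 0" if "y \<in> topspace Y" for y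
  proof -
    have "(\<lambda>n. f (\<sigma> n, y)) \<longlonglongrightarrow> f (x, y)"
      using that \<sigma> by (intro s_continuousD[OF f]) (auto simp: limitin_pairwise comp_def)
    then show ?thesis
      unfolding d_def by (intro tendsto_rabs_zero) (simp add: LIM_zero)
  qed
  have bdd: "bdd_above ((\<lambda>n. d n y) ` A)" if "y \<in> topspace Y" for y A
  proof -
    have "Bseq (\<lambda>n. d n y)" using d0[OF that] by (blast intro: convergent_imp_Bseq convergentI)
    then obtain B where "\<And>n. \<bar>d n y\<bar> \<le> B" unfolding Bseq_def by auto
    then show ?thesis by (intro bdd_aboveI2[of _ _ B]) (auto simp: abs_le_iff)
  qed
  have contN: "continuous_map (subtopology Y N) euclideanreal (h m)" for m
  proof (rule continuous_map_from_subtopology)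
    have "s_continuous Y (h m)"
    proof (rule s_continuousI[OF assms(1)])
      fix \<tau> y assume \<tau>: "range \<tau> \<subseteq> topspace Y" "limitin Y \<tau> y sequentially"
      have y: "y \<in> topspace Y" using \<tau>(2) by (rule limitin_topspace)
      show "(\<lambda>k. h m (\<tau> k)) \<longlonglongrightarrow> h m y"
      proof (rule LIMSEQ_I)
        fix r :: real assume "r > 0"
        have "\<exists>K. \<forall>k\<ge>K. \<forall>n. \<bar>f (\<sigma> n, \<tau> k) - f (\<sigma> n, y)\<bar> < r/4"
          by (rule s_continuous_prod_uniform[OF f \<sigma> \<tau>]) (use \<open>r > 0\<close> in simp)
        \<comment> \<open>The constant sequence at \<open>x\<close> reduces the slice over
          \<open>x\<close> to the same lemma; the index \<open>n\<close> is then a dummy.\<close>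
        moreover have "\<exists>K. \<forall>k\<ge>K. \<forall>n::nat. \<bar>f (x, \<tau> k) - f (x, y)\<bar> < r/4"
          by (rule s_continuous_prod_uniform[OF f, of "\<lambda>_. x" x \<tau> y])
            (use \<open>r > 0\<close> x \<tau> in \<open>auto simp: limitin_def\<close>)
        ultimately obtain K K' where
          K: "\<And>k n. k \<ge> K \<Longrightarrow> \<bar>f (\<sigma> n, \<tau> k) - f (\<sigma> n, y)\<bar> < r/4"
            "\<And>k. k \<ge> K' \<Longrightarrow> \<bar>f (x, \<tau> k) - f (x, y)\<bar> < r/4"
          by blast
        have "norm (h m (\<tau> k) - h m y) < r" if k: "k \<ge> max K K'" for k
        proof -
          \<comment> \<open>Two errors below \<open>r/4\<close> add up to at most
            \<open>r/2\<close>. The supremum preserves only a non-strict bound, which is still below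
            \<open>r\<close>.\<close>
          have "\<bar>d n (\<tau> k) - d n y\<bar> \<le> r/2" for n
            using K(1)[of k n] K(2)[of k] k unfolding d_def by linarith
          then have "\<bar>h m (\<tau> k) - h m y\<bar> \<le> r/2"
            unfolding h_def using \<tau>(1) y by (intro abs_cSUP_diff_le bdd) auto
          then show ?thesis using \<open>r > 0\<close> by simp
        qed
        then show "\<exists>K. \<forall>k\<ge>K. norm (h m (\<tau> k) - h m y) < r" by blast
      qed
    qed
    then show "continuous_map Y euclideanreal (h m)"
      using assms(2) unfolding s_R_space_def by blast
  qed
  have "\<exists>m. \<forall>y\<in>topspace (subtopology Y N). h m y < e"
  proof (rule pseudocompact_Dini[OF N(2) contN _ _ \<open>e > 0\<close>])
    fix y m n assume y: "y \<in> topspace (subtopology Y N)" and "(m::nat) \<le> n"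
    then show "h n y \<le> h m y"
      unfolding h_def by (intro cSUP_subset_mono bdd) auto
  next
    fix y assume y: "y \<in> topspace (subtopology Y N)"
    then have yY: "y \<in> topspace Y" by simp
    show "(\<lambda>m. h m y) \<longlonglongrightarrow> 0"
    proof (rule LIMSEQ_I)
      fix r :: real assume "r > 0"
      then obtain M where M: "\<And>n. n \<ge> M \<Longrightarrow> d n y < r/2"
        using LIMSEQ_D[OF d0[OF yY], of "r/2"] by fastforce
      have "norm (h m y - 0) < r" if "m \<ge> M" for m
      proof -
        have "h m y \<le> r/2"
          unfolding h_def using M that by (intro cSUP_least) (auto intro: less_imp_le)
        moreover have "d m y \<le> h m y"
          unfolding h_def by (rule cSUP_upper[OF _ bdd[OF yY]]) simp
        then have "0 \<le> h m y" by (simp add: d_def)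
        ultimately show ?thesis using \<open>r > 0\<close> by simp
      qed
      then show "\<exists>M. \<forall>m\<ge>M. norm (h m y - 0) < r" by blast
    qed
  qed
  then obtain m where m: "\<And>y. y \<in> N \<Longrightarrow> h m y < e"
    using N(1) by (auto simp: topspace_subtopology_subset)
  have "\<bar>f (\<sigma> n, y) - f (x, y)\<bar> < e" if "n \<ge> m" "y \<in> N" for n y
  proof -
    have "d n y \<le> h m y"
      unfolding h_def using that N(1) by (intro cSUP_upper bdd) auto
    then show ?thesis using m[OF that(2)] by (simp add: d_def)
  qed
  then show ?thesis by blast
qed

lemma s_R_space_prod_topology:
  assumes X: "Hausdorff_space X" "s_R_space X"
    and Y: "Hausdorff_space Y" "s_R_space Y" "locally_pseudocompact_space Y"
  shows "s_R_space (prod_topology X Y)"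
  unfolding s_R_space_def
proof (intro allI impI)
  fix f assume f: "s_continuous (prod_topology X Y) f"
  have fY: "continuous_map Y euclideanreal (\<lambda>y. f (x, y))" if "x \<in> topspace X" for x
  proof -
    have "s_continuous Y (f \<circ> (\<lambda>y. (x, y)))"
      using that by (intro s_continuous_compose[OF _ f Y(1)]) (simp add: continuous_map_pairedI)
    then show ?thesis using Y(2) unfolding s_R_space_def by (auto simp: comp_def)
  qed
  show "continuous_map (prod_topology X Y) euclideanreal f"
    unfolding continuous_map_real_eps
  proof (intro ballI allI impI)
    fix z and e :: real assume z: "z \<in> topspace (prod_topology X Y)" and e: "e > 0"
    obtain a b where ab: "z = (a, b)" "a \<in> topspace X" "b \<in> topspace Y" using z by auto
    obtain U N where N: "openin Y U" "b \<in> U" "U \<subseteq> N" "N \<subseteq> topspace Y"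
      "pseudocompact_space (subtopology Y N)"
      using Y(3) ab(3) unfolding locally_pseudocompact_space_def by meson
    have "N \<noteq> {}" using N by auto
    define d where "d x y = \<bar>f (x, y) - f (a, y)\<bar>" for x y
    define g where "g x = (SUP y\<in>N. d x y)" for x
    \<comment> \<open>Pseudocompactness of \<open>N\<close> enters here a second time, now to make
      the supremum defining \<open>g\<close> finite.\<close>
    have bdd: "bdd_above (d x ` N)" if "x \<in> topspace X" for x
    proof -
      have "continuous_map (subtopology Y N) euclideanreal (d x)"
        unfolding d_def using that ab(2)
        by (intro continuous_map_from_subtopology continuous_intros fY)
      then have "bounded (d x ` topspace (subtopology Y N))"
        using N(5) unfolding pseudocompact_space_def by blast
      then show ?thesis
        using N(4) by (simp add: Int_absorb1 bounded_imp_bdd_above)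
    qed
    \<comment> \<open>Along a convergent sequence in \<open>X\<close> the values of \<open>f\<close>
      converge uniformly over \<open>N\<close>, so the suprema over \<open>N\<close> converge
      too.\<close>
    have "s_continuous X g"
    proof (rule s_continuousI[OF X(1)])
      fix \<sigma> x assume \<sigma>: "range \<sigma> \<subseteq> topspace X" "limitin X \<sigma> x sequentially"
      have x: "x \<in> topspace X" using \<sigma>(2) by (rule limitin_topspace)
      show "(\<lambda>n. g (\<sigma> n)) \<longlonglongrightarrow> g x"
      proof (rule LIMSEQ_I)
        fix r :: real assume "r > 0"
        then have "\<exists>m. \<forall>n\<ge>m. \<forall>y\<in>N. \<bar>f (\<sigma> n, y) - f (x, y)\<bar> < r/2"
          using s_continuous_prod_uniform_on_pseudocompact[OF Y(1,2) f \<sigma> N(4,5), of "r/2"] by simp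
        then obtain m where m: "\<And>n y. n \<ge> m \<Longrightarrow> y \<in> N \<Longrightarrow> \<bar>f (\<sigma> n, y) - f (x, y)\<bar> < r/2"
          by blast
        have "norm (g (\<sigma> n) - g x) < r" if "n \<ge> m" for n
        proof -
          have "\<bar>d (\<sigma> n) y - d x y\<bar> \<le> r/2" if "y \<in> N" for y
            using m[OF \<open>n \<ge> m\<close> that] unfolding d_def by linarith
          then have "\<bar>g (\<sigma> n) - g x\<bar> \<le> r/2"
            unfolding g_def using \<sigma>(1) x \<open>N \<noteq> {}\<close> by (intro abs_cSUP_diff_le bdd) auto
          then show ?thesis using \<open>r > 0\<close> by simp
        qed
        then show "\<exists>m. \<forall>n\<ge>m. norm (g (\<sigma> n) - g x) < r" by blast
      qed
    qed
    then have "continuous_map X euclideanreal g"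
      using X(2) unfolding s_R_space_def by blast
    moreover have "g a = 0" unfolding g_def d_def using \<open>N \<noteq> {}\<close> by simp
    ultimately obtain V where V: "openin X V" "a \<in> V" "\<And>x. x \<in> V \<Longrightarrow> \<bar>g x\<bar> < e/2"
      using ab(2) e unfolding continuous_map_real_eps by (metis diff_zero half_gt_zero)
    obtain W where W: "openin Y W" "b \<in> W" "\<And>y. y \<in> W \<Longrightarrow> \<bar>f (a, y) - f (a, b)\<bar> < e/2"
      using fY[OF ab(2)] ab(3) e unfolding continuous_map_real_eps by (metis half_gt_zero)
    \<comment> \<open>On this box \<open>f (x, y)\<close> is compared with \<open>f (a, y)\<close>
      through \<open>g\<close>, then \<open>f (a, y)\<close> with \<open>f (a, b)\<close> through
      \<open>W\<close>. The factor \<open>U\<close> keeps \<open>y\<close> inside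
      \<open>N\<close>.\<close>
    let ?O = "V \<times> (U \<inter> W)"
    have "\<bar>f w - f z\<bar> < e" if wO: "w \<in> ?O" for w
    proof -
      obtain x y where w: "w = (x, y)" "x \<in> V" "y \<in> U" "y \<in> W" using wO by auto
      have "x \<in> topspace X" using w(2) openin_subset[OF V(1)] by blast
      then have "d x y \<le> g x"
        unfolding g_def using w N(3) by (intro cSUP_upper bdd) auto
      then show ?thesis
        using V(3)[OF w(2)] W(3)[OF w(4)] unfolding w ab d_def by linarith
    qed
    moreover have "openin (prod_topology X Y) ?O" "z \<in> ?O"
      using V W N(1,2) ab by (auto simp: openin_prod_Times_iff)
    ultimately show "\<exists>U. openin (prod_topology X Y) U \<and> z \<in> U \<and> (\<forall>y\<in>U. \<bar>f y - f z\<bar> < e)"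
      by blast
  qed
qed

subsection \<open>The sequential fan\<close>

text \<open>The apex \<open>(q, 0)\<close> is itself one of the points of branch \<open>q\<close>, so that no extra point has to be
  adjoined to the type. All other points are isolated.\<close>

definition fan_topology :: "'i \<Rightarrow> ('i \<times> nat) topology" where
  "fan_topology q = topology (\<lambda>W. (q, 0) \<in> W \<longrightarrow> (\<forall>i. finite {n. (i, n) \<notin> W}))"

lemma openin_fan_topology:
  "openin (fan_topology q) W \<longleftrightarrow> ((q, 0) \<in> W \<longrightarrow> (\<forall>i. finite {n. (i, n) \<notin> W}))"
proof -
  have "istopology (\<lambda>W. (q, 0) \<in> W \<longrightarrow> (\<forall>i. finite {n::nat. (i, n) \<notin> W}))"
    unfolding istopology_def
  proof (intro conjI allI impI)
    fix S T :: "('a \<times> nat) set" and i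
    assume "(q, 0) \<in> S \<longrightarrow> (\<forall>i. finite {n. (i, n) \<notin> S})"
      "(q, 0) \<in> T \<longrightarrow> (\<forall>i. finite {n. (i, n) \<notin> T})" "(q, 0) \<in> S \<inter> T"
    then have "finite ({n. (i, n) \<notin> S} \<union> {n. (i, n) \<notin> T})" by simp
    then show "finite {n. (i, n) \<notin> S \<inter> T}"
      by (rule rev_finite_subset) auto
  next
    fix K :: "('a \<times> nat) set set" and i
    assume K: "\<forall>W\<in>K. (q, 0) \<in> W \<longrightarrow> (\<forall>i. finite {n. (i, n) \<notin> W})"
      "(q, 0) \<in> \<Union> K"
    then obtain W where "W \<in> K" "(q, 0) \<in> W" by blast
    then have "finite {n. (i, n) \<notin> W}" using K(1) by blast
    then show "finite {n. (i, n) \<notin> \<Union> K}"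
      by (rule rev_finite_subset) (use \<open>W \<in> K\<close> in auto)
  qed
  then show ?thesis unfolding fan_topology_def by simp
qed

lemma topspace_fan_topology [simp]: "topspace (fan_topology q) = UNIV"
  using openin_subset[of "fan_topology q" UNIV] by (auto simp: openin_fan_topology)

lemma openin_fan_topology_sing: "z \<noteq> (q, 0) \<Longrightarrow> openin (fan_topology q) {z}"
  by (auto simp: openin_fan_topology)

lemma openin_fan_topology_Compl_sing: "openin (fan_topology q) (- {z})"
proof -
  have "finite {n. (i, n) \<notin> - {z}}" for i
    by (rule finite_subset[of _ "{snd z}"]) auto
  then show ?thesis by (simp add: openin_fan_topology)
qed

lemma Hausdorff_space_fan_topology: "Hausdorff_space (fan_topology q)"
  unfolding Hausdorff_space_def
proof (intro allI impI, elim conjE)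
  fix a b :: "'a \<times> nat" assume "a \<noteq> b"
  show "\<exists>U V. openin (fan_topology q) U \<and> openin (fan_topology q) V \<and> a \<in> U \<and> b \<in> V \<and> disjnt U V"
  proof (cases "a = (q, 0)")
    case True
    with \<open>a \<noteq> b\<close> show ?thesis
      by (intro exI[of _ "- {b}"] exI[of _ "{b}"])
        (auto simp: openin_fan_topology_sing openin_fan_topology_Compl_sing disjnt_def)
  next
    case False
    with \<open>a \<noteq> b\<close> show ?thesis
      by (intro exI[of _ "{a}"] exI[of _ "- {a}"])
        (auto simp: openin_fan_topology_sing openin_fan_topology_Compl_sing disjnt_def)
  qed
qed

text \<open>The fan has a base of clopen sets, whose indicators separate points from closed sets. An
  open set containing the apex is clopen because its complement omits the apex; any other point is a
  clopen singleton.\<close>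

lemma tychonoff_space_fan_topology: "tychonoff_space (fan_topology q)"
  unfolding tychonoff_space_def completely_regular_space_alt'
proof (intro conjI allI impI Hausdorff_space_fan_topology)
  fix S and z :: "'a \<times> nat" assume S: "openin (fan_topology q) S" "z \<in> S"
  obtain U where U: "openin (fan_topology q) U" "openin (fan_topology q) (- U)" "z \<in> U" "U \<subseteq> S"
  proof (cases "z = (q, 0)")
    case True
    show ?thesis
      by (rule that[of S]) (use True S in \<open>auto simp: openin_fan_topology\<close>)
  next
    case False
    show ?thesis
      by (rule that[of "{z}"])
        (use S False in \<open>auto simp: openin_fan_topology_sing openin_fan_topology_Compl_sing\<close>)
  qed
  let ?f = "\<lambda>w. if w \<in> U then 0 else 1 :: real"
  have "continuous_map (fan_topology q) euclideanreal ?f"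
    unfolding continuous_map_real_eps
  proof (intro ballI allI impI)
    fix w and e :: real assume "e > 0"
    show "\<exists>V. openin (fan_topology q) V \<and> w \<in> V \<and> (\<forall>y\<in>V. \<bar>?f y - ?f w\<bar> < e)"
      by (rule exI[of _ "if w \<in> U then U else - U"]) (use U \<open>e > 0\<close> in auto)
  qed
  with U show "\<exists>f. continuous_map (fan_topology q) euclideanreal f \<and> f z = 0 \<and>
      f ` (topspace (fan_topology q) - S) \<subseteq> {1}"
    by (intro exI[of _ ?f]) auto
qed

lemma frechet_urysohn_space_fan_topology: "frechet_urysohn_space (fan_topology q)"
  unfolding frechet_urysohn_space_def
proof (intro allI impI, elim conjE)
  fix A and a :: "'a \<times> nat" assume a: "a \<in> fan_topology q closure_of A"
  show "\<exists>\<sigma>. range \<sigma> \<subseteq> A \<and> limitin (fan_topology q) \<sigma> a sequentially"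
  proof (cases "a \<in> A")
    case True
    then show ?thesis by (intro exI[of _ "\<lambda>_. a"]) (auto simp: limitin_def)
  next
    case False
    have meet: "\<exists>y. y \<in> A \<and> y \<in> W" if "openin (fan_topology q) W" "a \<in> W" for W
      using a that unfolding in_closure_of by blast
    have aq: "a = (q, 0)"
      using meet[of "{a}"] False openin_fan_topology_sing[of a q] by auto
    \<comment> \<open>Failure of openness at the apex means that some branch meets \<open>A\<close>
      infinitely often; enumerating \<open>A\<close> along that branch gives the sequence.\<close>
    have "\<not> openin (fan_topology q) (- A)" using meet[of "- A"] False by auto
    then obtain i where inf: "infinite {n. (i, n) \<in> A}"
      by (auto simp: openin_fan_topology)
    let ?\<sigma> = "\<lambda>k. (i, enumerate {n. (i, n) \<in> A} k)"
    have "limitin (fan_topology q) ?\<sigma> a sequentially"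
      unfolding limitin_sequentially
    proof (intro conjI allI impI)
      fix W assume "openin (fan_topology q) W \<and> a \<in> W"
      then have "finite {n. (i, n) \<notin> W}" unfolding aq openin_fan_topology by blast
      then obtain M where M: "{n. (i, n) \<notin> W} \<subseteq> {..<M}"
        using finite_nat_bounded by metis
      have "?\<sigma> k \<in> W" if "M \<le> k" for k
      proof (rule ccontr)
        assume "?\<sigma> k \<notin> W"
        then have "enumerate {n. (i, n) \<in> A} k < M" using M by auto
        then show False using le_enumerate[OF inf, of k] that by linarith
      qed
      then show "\<exists>M. \<forall>k. M \<le> k \<longrightarrow> ?\<sigma> k \<in> W" by blast
    qed simp
    moreover have "range ?\<sigma> \<subseteq> A" using enumerate_in_set[OF inf] by auto
    ultimately show ?thesis by blast
  qed
qed

text \<open>Pick one visited point other than the apex on each visited branch. The set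
  \<open>R\<close> of these points meets every branch at most once, so its complement is a
  neighbourhood of the apex. The sequence therefore enters \<open>R\<close> only finitely often, and
  \<open>R\<close> is finite.\<close>

lemma fan_topology_limit_finite_branches:
  assumes "limitin (fan_topology q) \<sigma> (q, 0) sequentially"
  shows "finite (fst ` (range \<sigma> - {(q, 0)}))"
proof -
  define B where "B = fst ` (range \<sigma> - {(q, 0)})"
  have "\<forall>i\<in>B. \<exists>n. (i, n) \<in> range \<sigma> \<and> (i, n) \<noteq> (q, 0)"
  proof
    fix i assume "i \<in> B"
    then obtain z where z: "z \<in> range \<sigma>" "z \<noteq> (q, 0)" "i = fst z" unfolding B_def by blast
    have "(i, snd z) = z" using z(3) by simp
    then show "\<exists>n. (i, n) \<in> range \<sigma> \<and> (i, n) \<noteq> (q, 0)"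
      using z(1,2) by (intro exI[of _ "snd z"]) simp
  qed
  then obtain c where c: "\<forall>i\<in>B. (i, c i) \<in> range \<sigma> \<and> (i, c i) \<noteq> (q, 0)"
    unfolding bchoice_iff by blast
  define R where "R = (\<lambda>i. (i, c i)) ` B"
  have R: "R \<subseteq> range \<sigma>" "(q, 0) \<notin> R"
    using c unfolding R_def by (blast, metis imageE)
  have "finite {n. (i, n) \<notin> - R}" for i
    by (rule finite_subset[of _ "{c i}"]) (auto simp: R_def)
  then have "openin (fan_topology q) (- R)" unfolding openin_fan_topology by blast
  moreover have "(q, 0) \<in> - R" using R(2) by simp
  ultimately obtain K where K: "\<And>k. k \<ge> K \<Longrightarrow> \<sigma> k \<notin> R"
    using assms unfolding limitin_sequentially by blast
  have "R \<subseteq> \<sigma> ` {..<K}"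
  proof
    fix z assume z: "z \<in> R"
    then obtain k where "z = \<sigma> k" using R(1) by blast
    with z K[of k] show "z \<in> \<sigma> ` {..<K}" by (cases "k < K") auto
  qed
  then have "finite R" by (rule finite_subset) simp
  then have "finite (fst ` R)" by (rule finite_imageI)
  then show ?thesis unfolding R_def B_def by (simp add: image_image)
qed

section \<open>Locally finite bumps and the sequentially continuous function on the fan
  product\<close>

definition locally_finite_supports :: "'a topology \<Rightarrow> (nat \<Rightarrow> 'a \<Rightarrow> real) \<Rightarrow> bool" where
  "locally_finite_supports Y \<phi> \<longleftrightarrow>
    (\<forall>y\<in>topspace Y. \<exists>V. openin Y V \<and> y \<in> V \<and> finite {n. \<exists>z\<in>V. \<phi> n z \<noteq> 0})"

text \<open>An unbounded continuous \<open>g\<close> on the closure of \<open>U\<close> is unbounded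
  on \<open>U\<close> by density. The \<open>n\<close>-th bump lives in \<open>V n\<close>, the part
  of \<open>U\<close> where \<open>\<bar>g\<bar>\<close> exceeds \<open>n\<close>. These sets are
  locally finite because \<open>g\<close> is locally bounded on the closure, and points off the
  closure have a neighbourhood missing all of them.\<close>

lemma exists_locally_finite_bumps:
  assumes Y: "completely_regular_space Y"
    and U: "openin Y U" and npc: "\<not> pseudocompact_space (subtopology Y (Y closure_of U))"
  shows "\<exists>\<phi>. (\<forall>n. continuous_map Y euclideanreal (\<phi> n)) \<and> (\<forall>n. \<exists>v\<in>U. \<phi> n v = 1) \<and>
    locally_finite_supports Y \<phi>"
proof -
  define N where "N = Y closure_of U"
  have UN: "U \<subseteq> N" unfolding N_def by (rule closure_of_subset[OF openin_subset[OF U]])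
  have N: "closedin Y N" "N \<subseteq> topspace Y" by (simp_all add: N_def closure_of_subset_topspace)
  obtain g where g: "continuous_map (subtopology Y N) euclideanreal g"
    and unb: "\<not> bounded (g ` topspace (subtopology Y N))"
    using npc unfolding pseudocompact_space_def N_def by blast
  \<comment> \<open>As \<open>g\<close> is continuous only on \<open>N\<close>, its open preimages
    are replaced by open sets of \<open>Y\<close> with the same trace on \<open>N\<close>.\<close>
  have open_g: "\<exists>W. openin Y W \<and> (\<forall>z\<in>N. z \<in> W \<longleftrightarrow> g z \<in> S)" if "open S" for S
  proof -
    have "openin (subtopology Y N) {z \<in> topspace (subtopology Y N). g z \<in> S}"
      using openin_continuous_map_preimage[OF g] that by simp
    then obtain W where W: "openin Y W" "{z \<in> topspace (subtopology Y N). g z \<in> S} = W \<inter> N"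
      unfolding openin_subtopology by blast
    have "z \<in> W \<longleftrightarrow> g z \<in> S" if "z \<in> N" for z
    proof -
      have "z \<in> W \<longleftrightarrow> z \<in> W \<inter> N" using that by blast
      also have "\<dots> \<longleftrightarrow> g z \<in> S" unfolding W(2)[symmetric] using that N(2) by auto
      finally show ?thesis .
    qed
    with W(1) show ?thesis by blast
  qed
  have far: "\<exists>W. openin Y W \<and> (\<forall>z\<in>N. z \<in> W \<longleftrightarrow> \<bar>g z\<bar> > real n)" for n
  proof -
    have "open (- {- real n..real n})" by (intro open_Compl closed_atLeastAtMost)
    moreover have "t \<in> - {- real n..real n} \<longleftrightarrow> \<bar>t\<bar> > real n" for t by auto
    ultimately show ?thesis using open_g[of "- {- real n..real n}"] by simp
  qed
  have big: "\<exists>v\<in>U. \<bar>g v\<bar> > real n" for n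
  proof (rule ccontr)
    assume neg: "\<not> ?thesis"
    have "\<bar>g y\<bar> \<le> real n" if y: "y \<in> N" for y
    proof (rule ccontr)
      assume gy: "\<not> \<bar>g y\<bar> \<le> real n"
      obtain W where W: "openin Y W" "\<And>z. z \<in> N \<Longrightarrow> z \<in> W \<longleftrightarrow> \<bar>g z\<bar> > real n"
        using far[of n] by metis
      then have "y \<in> W" using y gy by simp
      then obtain u where "u \<in> U" "u \<in> W" using W(1) y unfolding N_def in_closure_of by blast
      moreover have "u \<in> N" using \<open>u \<in> U\<close> UN by blast
      ultimately show False using neg W(2)[of u] by simp
    qed
    then have "bounded (g ` topspace (subtopology Y N))"
      unfolding bounded_iff by (intro exI[of _ "real n"]) auto
    with unb show False ..
  qed
  define V where "V n = {z \<in> U. \<bar>g z\<bar> > real n}" for n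
  have openV: "openin Y (V n)" for n
  proof -
    obtain W where W: "openin Y W" "\<And>z. z \<in> N \<Longrightarrow> z \<in> W \<longleftrightarrow> \<bar>g z\<bar> > real n"
      using far[of n] by metis
    have "V n = U \<inter> W" using UN W(2) unfolding V_def by (intro set_eqI) (simp add: subset_iff, metis)
    then show ?thesis using U W(1) by auto
  qed
  have "\<exists>\<phi>. continuous_map Y euclideanreal \<phi> \<and> (\<exists>v\<in>U. \<phi> v = 1) \<and> (\<forall>z\<in>topspace Y - V n. \<phi> z = 0)" for n
  proof -
    obtain v where v: "v \<in> V n" "v \<in> U" using big[of n] by (auto simp: V_def)
    obtain \<phi> where "continuous_map Y euclideanreal \<phi>" "\<phi> v = 1" "\<phi> ` (topspace Y - V n) \<subseteq> {0}"
      using Y openV[of n] v(1) unfolding completely_regular_space_gen_alt'[OF zero_neq_one[symmetric]]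
      by blast
    with v(2) show ?thesis by (intro exI[of _ \<phi>]) auto
  qed
  then obtain \<phi> where \<phi>: "\<And>n. continuous_map Y euclideanreal (\<phi> n)" "\<And>n. \<exists>v\<in>U. \<phi> n v = 1"
    "\<And>n z. z \<in> topspace Y - V n \<Longrightarrow> \<phi> n z = 0"
    by metis
  have "\<exists>W. openin Y W \<and> y \<in> W \<and> finite {n. \<exists>z\<in>W. \<phi> n z \<noteq> 0}" if y: "y \<in> topspace Y" for y
  proof -
    \<comment> \<open>Off the closed set \<open>N\<close> the complement of \<open>N\<close> serves
      as \<open>W\<close>, and the bound holds vacuously with \<open>M = 0\<close>.\<close>
    obtain W M where W: "openin Y W" "y \<in> W" "\<And>z. z \<in> W \<Longrightarrow> z \<in> N \<Longrightarrow> \<bar>g z\<bar> < real M"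
    proof (cases "y \<in> N")
      case True
      obtain M :: nat where M: "\<bar>g y\<bar> < real M" using reals_Archimedean2 by blast
      obtain W where W: "openin Y W" "\<And>z. z \<in> N \<Longrightarrow> z \<in> W \<longleftrightarrow> g z \<in> {- real M<..<real M}"
        using open_g[OF open_greaterThanLessThan, of "- real M" "real M"] by metis
      have "y \<in> W" using W(2)[OF True] M by auto
      moreover have "\<bar>g z\<bar> < real M" if "z \<in> W" "z \<in> N" for z
        using W(2)[OF that(2)] that(1) by auto
      ultimately show ?thesis by (intro that[OF W(1)])
    next
      case False
      show ?thesis
        by (rule that[of "topspace Y - N" 0]) (use False y N in auto)
    qed
    have "n < M" if "z \<in> W" "\<phi> n z \<noteq> 0" for n z
    proof -
      have "z \<in> V n" using \<phi>(3)[of z n] that openin_subset[OF W(1)] by blast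
      then have "z \<in> N" "real n < \<bar>g z\<bar>" using UN by (auto simp: V_def)
      then show ?thesis using W(3)[OF that(1)] by simp
    qed
    then have "{n. \<exists>z\<in>W. \<phi> n z \<noteq> 0} \<subseteq> {..<M}" by auto
    then show ?thesis using W(1,2) finite_subset by blast
  qed
  then show ?thesis using \<phi>(1,2) unfolding locally_finite_supports_def by blast
qed

text \<open>Away from the apex the first coordinate is eventually constant, so continuity of one
  bump suffices. Towards the apex only finitely many branches occur, and local finiteness on each of
  them makes the values eventually 0. The value of \<open>\<phi>\<close> at the apex index is
  overridden by 0.\<close>

lemma s_continuous_fan_bumps:
  assumes Y: "Hausdorff_space Y"
    and cont: "\<And>z. continuous_map Y euclideanreal (\<phi> z)"
    and lf: "\<And>i. locally_finite_supports Y (\<lambda>n. \<phi> (i, n))"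
  shows "s_continuous (prod_topology (fan_topology q) Y)
    (\<lambda>(z, y). if z = (q, 0) then 0 else \<phi> z y)" (is "s_continuous _ ?F")
proof (rule s_continuousI)
  show "Hausdorff_space (prod_topology (fan_topology q) Y)"
    by (simp add: Hausdorff_space_prod_topology Hausdorff_space_fan_topology Y)
next
  fix \<sigma> l
  assume ran: "range \<sigma> \<subseteq> topspace (prod_topology (fan_topology q) Y)"
    and lim: "limitin (prod_topology (fan_topology q) Y) \<sigma> l sequentially"
  define x where "x = fst \<circ> \<sigma>"
  define y where "y = snd \<circ> \<sigma>"
  obtain a b where l: "l = (a, b)" by (cases l)
  have x: "limitin (fan_topology q) x a sequentially" and y: "limitin Y y b sequentially"
    using lim by (simp_all add: limitin_pairwise l x_def y_def)
  have F: "?F (\<sigma> k) = (if x k = (q, 0) then 0 else \<phi> (x k) (y k))" for k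
    by (simp add: x_def y_def case_prod_beta)
  show "(\<lambda>k. ?F (\<sigma> k)) \<longlonglongrightarrow> ?F l"
  proof (cases "a = (q, 0)")
    case False
    then have "\<forall>\<^sub>F k in sequentially. x k \<in> {a}"
      using x openin_fan_topology_sing[OF False] unfolding limitin_def by blast
    then have "\<forall>\<^sub>F k in sequentially. \<phi> a (y k) = ?F (\<sigma> k)"
      by (rule eventually_mono) (use False F in auto)
    moreover have "(\<lambda>k. \<phi> a (y k)) \<longlonglongrightarrow> \<phi> a b"
      using continuous_map_limit[OF cont y] by (simp add: comp_def)
    ultimately have "(\<lambda>k. ?F (\<sigma> k)) \<longlonglongrightarrow> \<phi> a b"
      using tendsto_cong by force
    then show ?thesis using False l by simp
  next
    case True
    define B where "B = fst ` (range x - {(q, 0)})"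
    have "finite B"
      unfolding B_def using x by (intro fan_topology_limit_finite_branches) (simp add: True)
    have b: "b \<in> topspace Y" using y by (rule limitin_topspace)
    have "\<forall>i. \<exists>V. openin Y V \<and> b \<in> V \<and> finite {n. \<exists>z\<in>V. \<phi> (i, n) z \<noteq> 0}"
      using lf b unfolding locally_finite_supports_def by blast
    from choice[OF this] obtain V where
      "\<forall>i. openin Y (V i) \<and> b \<in> V i \<and> finite {n. \<exists>z\<in>V i. \<phi> (i, n) z \<noteq> 0}" ..
    then have V: "\<And>i. openin Y (V i)" "\<And>i. b \<in> V i"
      "\<And>i. finite {n. \<exists>z\<in>V i. \<phi> (i, n) z \<noteq> 0}"
      by simp_all
    let ?E = "\<lambda>i. {n. \<exists>z\<in>V i. \<phi> (i, n) z \<noteq> 0}"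
    \<comment> \<open>Each branch \<open>i\<close> loses only the finitely many indices whose bump
      is nonzero somewhere on \<open>V i\<close>, so this is a neighbourhood of the apex.\<close>
    let ?W = "{z. z = (q, 0) \<or> snd z \<notin> ?E (fst z)}"
    have "finite {n. (i, n) \<notin> ?W}" for i
      using V(3)[of i] by (rule rev_finite_subset) auto
    then have "openin (fan_topology q) ?W" unfolding openin_fan_topology by blast
    moreover have "a \<in> ?W" using True by simp
    ultimately have ev1: "\<forall>\<^sub>F k in sequentially. x k \<in> ?W"
      using x unfolding limitin_def by blast
    \<comment> \<open>The neighbourhoods \<open>V i\<close> depend on the branch; finiteness of
      \<open>B\<close> lets the sequence enter all the relevant ones simultaneously.\<close>
    have ev2: "\<forall>\<^sub>F k in sequentially. \<forall>i\<in>B. y k \<in> V i"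
      using \<open>finite B\<close> y V(1,2) by (intro eventually_ball_finite) (auto simp: limitin_def)
    have "\<forall>\<^sub>F k in sequentially. 0 = ?F (\<sigma> k)"
      using ev1 ev2
    proof eventually_elim
      case (elim k)
      show ?case
      proof (cases "x k = (q, 0)")
        case False
        then have "fst (x k) \<in> B" unfolding B_def by blast
        then have "y k \<in> V (fst (x k))" using elim(2) by blast
        then have "\<phi> (fst (x k), snd (x k)) (y k) = 0" using elim(1) False by blast
        then show ?thesis using F[of k] by simp
      qed (simp add: F)
    qed
    then have "(\<lambda>k. ?F (\<sigma> k)) \<longlonglongrightarrow> 0" using tendsto_cong by force
    then show ?thesis using True l by simp
  qed
qed

section \<open>From products back to the factor \<open>Y\<close>, and the equivalences\<close>

lemma s_R_space_prod_topology_imp_snd: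
  assumes "s_R_space (prod_topology X Y)" "a \<in> topspace X" "Hausdorff_space X" "Hausdorff_space Y"
  shows "s_R_space Y"
  unfolding s_R_space_def
proof (intro allI impI)
  fix f assume f: "s_continuous Y f"
  have "Hausdorff_space (prod_topology X Y)"
    using assms(3,4) by (simp add: Hausdorff_space_prod_topology)
  then have "s_continuous (prod_topology X Y) (f \<circ> snd)"
    by (rule s_continuous_compose[OF continuous_map_snd f])
  then have cont: "continuous_map (prod_topology X Y) euclideanreal (f \<circ> snd)"
    using assms(1) unfolding s_R_space_def by blast
  have "continuous_map Y (prod_topology X Y) (\<lambda>y. (a, y))"
    using assms(2) by (simp add: continuous_map_pairedI)
  from continuous_map_compose[OF this cont]
  show "continuous_map Y euclideanreal f" by (simp add: comp_def)
qed

text \<open>Branches are indexed by all sets of points, so every neighbourhood of \<open>y0\<close>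
  owns one. The branch containing the apex is indexed by the empty set, which is never a
  neighbourhood of \<open>y0\<close>.\<close>

lemma locally_pseudocompact_if_s_R_space_prod_fan:
  fixes Y :: "'a topology"
  assumes Y: "tychonoff_space Y"
    and prod: "s_R_space (prod_topology (fan_topology ({} :: 'a set)) Y)"
  shows "locally_pseudocompact_space Y"
proof (rule ccontr)
  let ?X = "fan_topology ({} :: 'a set)"
  assume "\<not> ?thesis"
  then obtain y0 where y0: "y0 \<in> topspace Y"
    and "\<not> (\<exists>U N. openin Y U \<and> y0 \<in> U \<and> U \<subseteq> N \<and> N \<subseteq> topspace Y \<and>
      pseudocompact_space (subtopology Y N))"
    unfolding locally_pseudocompact_space_def Ball_def by (auto simp del: not_ex)
  then have nbhd: "\<not> pseudocompact_space (subtopology Y N)"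
    if "openin Y U" "y0 \<in> U" "U \<subseteq> N" "N \<subseteq> topspace Y" for U N
    using that by blast
  have "\<exists>\<phi>. (\<forall>n. continuous_map Y euclideanreal (\<phi> n)) \<and> locally_finite_supports Y \<phi> \<and>
    (openin Y U \<and> y0 \<in> U \<longrightarrow> (\<forall>n. \<exists>v\<in>U. \<phi> n v = 1))" for U
  proof (cases "openin Y U \<and> y0 \<in> U")
    case True
    then have "\<not> pseudocompact_space (subtopology Y (Y closure_of U))"
      using nbhd[of U "Y closure_of U"]
      by (simp add: closure_of_subset openin_subset closure_of_subset_topspace)
    then show ?thesis
      using exists_locally_finite_bumps[of Y U] Y True unfolding tychonoff_space_def by blast
  next
    case False
    then show ?thesis
      \<comment> \<open>Branches whose index is not an open neighbourhood of \<open>y0\<close> carry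
        zero functions.\<close>
      by (intro exI[of _ "\<lambda>_ _. 0"]) (auto simp: locally_finite_supports_def)
  qed
  then obtain \<psi> where \<psi>: "\<And>U n. continuous_map Y euclideanreal (\<psi> U n)"
    "\<And>U. locally_finite_supports Y (\<psi> U)"
    "\<And>U n. openin Y U \<Longrightarrow> y0 \<in> U \<Longrightarrow> \<exists>v\<in>U. \<psi> U n v = 1"
    by metis
  let ?F = "\<lambda>(z, y). if z = ({}, 0) then 0 else (\<lambda>(U, n). \<psi> U n) z y"
  have "s_continuous (prod_topology ?X Y) ?F"
    using Y \<psi>(1,2) by (intro s_continuous_fan_bumps) (auto simp: tychonoff_space_def)
  then have cont: "continuous_map (prod_topology ?X Y) euclideanreal ?F"
    using prod unfolding s_R_space_def by blast
  have "(({}, 0), y0) \<in> topspace (prod_topology ?X Y)" using y0 by simp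
  from continuous_map_real_eps[THEN iffD1, OF cont, rule_format, OF this zero_less_one]
  obtain O' where "openin (prod_topology ?X Y) O' \<and> (({}, 0), y0) \<in> O' \<and>
    (\<forall>w\<in>O'. \<bar>?F w - ?F (({}, 0), y0)\<bar> < 1)" ..
  then have O': "openin (prod_topology ?X Y) O'" "(({}, 0), y0) \<in> O'"
    "\<And>w. w \<in> O' \<Longrightarrow> \<bar>?F w - ?F (({}, 0), y0)\<bar> < 1"
    by blast+
  from O'(1,2) obtain W G where WG: "openin ?X W" "openin Y G" "({}, 0) \<in> W" "y0 \<in> G" "W \<times> G \<subseteq> O'"
    unfolding openin_prod_topology_alt by meson
  \<comment> \<open>The box is defeated by the branch of its own second factor: almost all points of
    branch \<open>G\<close> lie in \<open>W\<close>, and each of their bumps reaches 1 inside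
    \<open>G\<close>.\<close>
  have "finite {n. (G, n) \<notin> W}" using WG(1,3) unfolding openin_fan_topology by blast
  then obtain n where n: "(G, n) \<in> W" using ex_new_if_finite[OF infinite_UNIV_nat] by blast
  obtain v where v: "v \<in> G" "\<psi> G n v = 1" using \<psi>(3) WG(2,4) by blast
  have "((G, n), v) \<in> O'" using n v(1) WG(5) by blast
  moreover have "G \<noteq> {}" using WG(4) by blast
  ultimately show False using O'(3)[of "((G, n), v)"] v(2) by simp
qed

text \<open>A formula cannot quantify over types, so the equivalences let \<open>X\<close> range
  over topologies on one type large enough to carry the fan. The last conjunct gives the forward
  implications for \<open>X\<close> on an arbitrary type.\<close>

theorem theorem4p9:
  fixes Y :: "'a topology"
  assumes "tychonoff_space Y"
  shows "(locally_pseudocompact_space Y \<and> s_R_space Y \<longleftrightarrow>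
            (\<forall>X :: ('a set \<times> nat) topology. tychonoff_space X \<and> s_R_space X \<longrightarrow>
               s_R_space (prod_topology X Y)))
       \<and> (locally_pseudocompact_space Y \<and> s_R_space Y \<longleftrightarrow>
            (\<forall>X :: ('a set \<times> nat) topology. tychonoff_space X \<and> frechet_urysohn_space X \<longrightarrow>
               s_R_space (prod_topology X Y)))
       \<and> (locally_pseudocompact_space Y \<and> s_R_space Y \<longrightarrow>
            (\<forall>X :: 'b topology. tychonoff_space X \<and> s_R_space X \<longrightarrow>
               s_R_space (prod_topology X Y)) \<and>
            (\<forall>X :: 'b topology. tychonoff_space X \<and> frechet_urysohn_space X \<longrightarrow>
               s_R_space (prod_topology X Y)))"
proof -
  let ?X = "fan_topology ({} :: 'a set)"
  have Y: "Hausdorff_space Y" using assms by (simp add: tychonoff_space_def)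
  have fan: "tychonoff_space ?X" "frechet_urysohn_space ?X" "s_R_space ?X"
    by (simp_all add: tychonoff_space_fan_topology frechet_urysohn_space_fan_topology
        frechet_urysohn_imp_s_R_space)
  \<comment> \<open>The fan is both Frechet-Urysohn and an \<open>s_R_space\<close>, so this one
    product settles the converse from (ii) and from (iii).\<close>
  have only_if: "locally_pseudocompact_space Y \<and> s_R_space Y"
    if "s_R_space (prod_topology ?X Y)"
    using locally_pseudocompact_if_s_R_space_prod_fan[OF assms that]
      s_R_space_prod_topology_imp_snd[OF that _ Hausdorff_space_fan_topology Y] by simp
  show ?thesis
    using only_if fan Y
    by (intro conjI iffI impI allI)
      (auto simp: tychonoff_space_def intro!: s_R_space_prod_topology
        intro: frechet_urysohn_imp_s_R_space)
qed

end
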